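(* Let $x_0,\dots,x_7\ge 0$ be real numbers. Then $$\begin{aligned} &\Bigl(\sum_{i=0}^{7}x_i\Bigr)^2\Bigl[\Bigl(\sum_{i=0}^{3}x_i\Bigr)\Bigl(\sum_{4\le i<j<k\le 7}x_ix_jx_k\Bigr)+\Bigl(\sum_{i=4}^{7}x_i\Bigr)\Bigl(\sum_{0\le i<j<k\le 3}x_ix_jx_k\Bigr)\\ &\qquad+(x_0+x_1)(x_2+x_3)(x_4x_5+x_6x_7)+(x_0+x_2)(x_1+x_3)(x_4x_6+x_5x_7)\\ &\qquad+(x_0+x_3)(x_1+x_2)(x_5x_6+x_4x_7)+2x_0x_3x_5x_6+2x_1x_2x_4x_7\Bigr]\\ &\le\Bigl(\sum_{i=0}^{3}x_i\Bigr)\Bigl(\sum_{i=4}^{7}x_i\Bigr)\Bigl(\sum_{i\in\{0,2,4,6\}}x_i\Bigr)\Bigl(\sum_{i\in\{1,3,5,7\}}x_i\Bigr)\Bigl(\sum_{i\in\{0,1,4,5\}}x_i\Bigr)\Bigl(\sum_{i\in\{2,3,6,7\}}x_i\Bigr). \end{aligned}$$ *)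

theory Defs
  imports Complex_Main
begin

end

theory Submission
  imports Defs
begin

text \<open>
  Index the variables by the vertices of the cube, \<open>i = 4a + 2b + c\<close>, so that the factors on the
  right-hand side are the sums over the six facets. The difference of the two sides is invariant under
  the symmetries of the cube. Six times this difference is the sum, over the 24 symmetries generated
  by the reflections and the cyclic shift of the coordinates, of a polynomial consisting of monomials
  with positive coefficients and of squares weighted by monomials \<open>x\<^sub>i x\<^sub>j\<close>. The squares
  are those of quadratic forms spanned by the differences \<open>x\<^sub>p x\<^sub>q - x\<^sub>r x\<^sub>s\<close> where the vertices satisfy
  \<open>p + q = r + s\<close> as vectors in \<open>\<int>\<^sup>3\<close>; their coefficients were found by linear programming.
\<close>

text \<open>In order of m = 0, ..., 7, the summands permute the indices by bitwise xor with
  m.\<close>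

definition flip_sum ::
  "(real \<Rightarrow> real \<Rightarrow> real \<Rightarrow> real \<Rightarrow> real \<Rightarrow> real \<Rightarrow> real \<Rightarrow> real \<Rightarrow> real) \<Rightarrow>
    real \<Rightarrow> real \<Rightarrow> real \<Rightarrow> real \<Rightarrow> real \<Rightarrow> real \<Rightarrow> real \<Rightarrow> real \<Rightarrow> real" where
  "flip_sum P a b c d e f g h =
    P a b c d e f g h + P b a d c f e h g + P c d a b g h e f + P d c b a h g f e +
    P e f g h a b c d + P f e h g b a d c + P g h e f c d a b + P h g f e d c b a"

text \<open>Cyclic shifts of the three index bits; they fix vertices 0 and 7.\<close>

definition rotation_sum ::
  "(real \<Rightarrow> real \<Rightarrow> real \<Rightarrow> real \<Rightarrow> real \<Rightarrow> real \<Rightarrow> real \<Rightarrow> real \<Rightarrow> real) \<Rightarrow>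
    real \<Rightarrow> real \<Rightarrow> real \<Rightarrow> real \<Rightarrow> real \<Rightarrow> real \<Rightarrow> real \<Rightarrow> real \<Rightarrow> real" where
  "rotation_sum P a b c d e f g h =
    P a b c d e f g h + P a c e g b d f h + P a e b f c g d h"

text \<open>The weights \<open>a * b\<close>, \<open>a * d\<close>, \<open>a * h\<close> of the
  squares are an edge, a face diagonal and a space diagonal: one pair of vertices from each
  orbit.\<close>

definition cert :: "real \<Rightarrow> real \<Rightarrow> real \<Rightarrow> real \<Rightarrow> real \<Rightarrow> real \<Rightarrow> real \<Rightarrow> real \<Rightarrow> real" where
  "cert a b c d e f g h =
    a * b * (8 * (c * f - d * e)\<^sup>2 + 3 * ((a + b) * (g + h) - (c + d) * (e + f))\<^sup>2)
    + a * d * (4 * (a * h - d * e)\<^sup>2 + ((a - d) * (f + g) - (e - h) * (b + c))\<^sup>2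
      + 2 * ((a + d) * (f - g) + (c - b) * (e + h) + c * f - b * g)\<^sup>2)
    + a * h * (d * (a + 3 * e + f + g) + e * (b + c + h)
      - a * (f + g + h) - b * (c + g + h) - c * (f + h) - f * g)\<^sup>2
    + 4 * a ^ 3 * d * f * g + 16 * a ^ 3 * d * f * h + 4 * a\<^sup>2 * b * c * e * h
    + 12 * a\<^sup>2 * b * c * h\<^sup>2 + 8 * a\<^sup>2 * b * d * f * g + 12 * a\<^sup>2 * d\<^sup>2 * f * g
    + 8 * a\<^sup>2 * d * f * g * h"

lemma cert_nonneg:
  assumes "0 \<le> a" "0 \<le> b" "0 \<le> c" "0 \<le> d" "0 \<le> e" "0 \<le> f" "0 \<le> g" "0 \<le> h"
  shows "0 \<le> cert a b c d e f g h"
  unfolding cert_def using assms by (intro add_nonneg_nonneg mult_nonneg_nonneg) simp_all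

lemma orbit_sum_nonneg:
  assumes "0 \<le> a" "0 \<le> b" "0 \<le> c" "0 \<le> d" "0 \<le> e" "0 \<le> f" "0 \<le> g" "0 \<le> h"
  shows "0 \<le> rotation_sum (flip_sum cert) a b c d e f g h"
  unfolding rotation_sum_def flip_sum_def
  using assms by (intro add_nonneg_nonneg cert_nonneg)

lemma difference_eq_orbit_sum:
  "6 * ((a + b + c + d) * (e + f + g + h) * (a + c + e + g) * (b + d + f + h)
      * (a + b + e + f) * (c + d + g + h)
    - (a + b + c + d + e + f + g + h)\<^sup>2 *
      ((a + b + c + d) * (e * f * g + e * f * h + e * g * h + f * g * h)
      + (e + f + g + h) * (a * b * c + a * b * d + a * c * d + b * c * d)
      + (a + b) * (c + d) * (e * f + g * h) + (a + c) * (b + d) * (e * g + f * h)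
      + (a + d) * (b + c) * (f * g + e * h) + 2 * a * d * f * g + 2 * b * c * e * h))
    = rotation_sum (flip_sum cert) a b c d e f g h"
  unfolding rotation_sum_def flip_sum_def cert_def by algebra

theorem theorem5p1:
  fixes x :: "nat \<Rightarrow> real"
  assumes "\<And>i. i \<le> 7 \<Longrightarrow> 0 \<le> x i"
  shows "(\<Sum>i=0..7. x i)\<^sup>2 *
      ((\<Sum>i=0..3. x i) * (\<Sum>(i, j, k)\<in>{(i, j, k). 4 \<le> i \<and> i < j \<and> j < k \<and> k \<le> 7}. x i * x j * x k)
       + (\<Sum>i=4..7. x i) * (\<Sum>(i, j, k)\<in>{(i, j, k). 0 \<le> i \<and> i < j \<and> j < k \<and> k \<le> 3}. x i * x j * x k)
       + (x 0 + x 1) * (x 2 + x 3) * (x 4 * x 5 + x 6 * x 7)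
       + (x 0 + x 2) * (x 1 + x 3) * (x 4 * x 6 + x 5 * x 7)
       + (x 0 + x 3) * (x 1 + x 2) * (x 5 * x 6 + x 4 * x 7)
       + 2 * x 0 * x 3 * x 5 * x 6
       + 2 * x 1 * x 2 * x 4 * x 7)
    \<le> (\<Sum>i=0..3. x i) * (\<Sum>i=4..7. x i)
      * (\<Sum>i\<in>{0, 2, 4, 6}. x i) * (\<Sum>i\<in>{1, 3, 5, 7}. x i)
      * (\<Sum>i\<in>{0, 1, 4, 5}. x i) * (\<Sum>i\<in>{2, 3, 6, 7}. x i)"
proof -
  have intervals: "{0..7} = {0, 1, 2, 3, 4, 5, 6, 7::nat}" "{0..3} = {0, 1, 2, 3::nat}"
    "{4..7} = {4, 5, 6, 7::nat}"
    by auto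
  have triples: "{(i, j, k). 4 \<le> i \<and> i < j \<and> j < k \<and> k \<le> 7} =
      {(4, 5, 6), (4, 5, 7), (4, 6, 7), (5, 6, 7::nat)}"
    "{(i, j, k). 0 \<le> i \<and> i < j \<and> j < k \<and> k \<le> 3} =
      {(0, 1, 2), (0, 1, 3), (0, 2, 3), (1, 2, 3::nat)}"
    by auto
  have "0 \<le> rotation_sum (flip_sum cert) (x 0) (x 1) (x 2) (x 3) (x 4) (x 5) (x 6) (x 7)"
    by (intro orbit_sum_nonneg assms) simp_all
  then show ?thesis
    \<comment> \<open>The orbit sum turns back into six times the difference; simp evaluates the
      listed sums and drops the factor 6.\<close>
    unfolding difference_eq_orbit_sum[symmetric] intervals triples
    by (simp add: add.assoc)
qed

end
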